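(* Let $K$ be a kernel on $\mathbb R$ such that $\int_{\varepsilon<|t|<1/\varepsilon}|K(t)|\,dt<\infty$ for every $\varepsilon>0$ (with $\varepsilon<1$). Let $\gamma=(\gamma_1,\dots,\gamma_n):\mathbb R\to\mathbb R^n$ be a curve for which there exists $1\le j\le n$ such that $\|\gamma_j\|_\infty<\infty$ and $$\mathrm{p.v.}\int_{\mathbb R}\gamma_j(t)K(t)\,dt=\infty.$$ Then the family of operators $$K_{\gamma,\varepsilon}f(x)=\int_{\varepsilon<|t|<1/\varepsilon}f(x-\gamma(t))K(t)\,dt,\qquad\varepsilon>0,$$ is not uniformly bounded on $L^2(\mathbb R^n)$; that is, $\sup_{\varepsilon>0}\|K_{\gamma,\varepsilon}\|_{L^2\to L^2}=\infty$.
   Context: A kernel is a measurable function on $\mathbb R$. The principal value integral being infinite means that the truncated integrals $\int_{\varepsilon<|t|<1/\varepsilon}\gamma_j(t)K(t)\,dt$ tend to infinity (in modulus) as $\varepsilon\to0^+$. *)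

theory Defs
  imports "HOL-Analysis.Analysis" "HOL-Probability.Essential_Supremum"
begin

definition trunc_region :: "real \<Rightarrow> real set" where
  "trunc_region \<epsilon> = {t. \<epsilon> < \<bar>t\<bar> \<and> \<bar>t\<bar> < 1 / \<epsilon>}"

text \<open>All measures are Lebesgue measure on the Lebesgue \<open>\<sigma>\<close>-algebra, and functions in
  \<open>L\<^sup>2\<close> are complex-valued.  The norm is extended-valued; the real square root is applied
  only where the integral is finite.\<close>

definition L2_norm :: "('a::euclidean_space \<Rightarrow> complex) \<Rightarrow> ennreal" where
  "L2_norm f =
     (let I = \<integral>\<^sup>+x. ennreal ((cmod (f x))\<^sup>2) \<partial>lebesgue
      in if I = \<infinity> then \<infinity> else ennreal (sqrt (enn2real I)))"

definition L2_fun :: "('a::euclidean_space \<Rightarrow> complex) set" where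
  "L2_fun = {f. f \<in> borel_measurable lebesgue \<and> L2_norm f < \<infinity>}"

text \<open>Operators act on representatives rather than on classes modulo null sets.\<close>

definition L2_op_norm ::
  "(('a::euclidean_space \<Rightarrow> complex) \<Rightarrow> ('a \<Rightarrow> complex)) \<Rightarrow> ennreal" where
  "L2_op_norm T = (SUP f\<in>{f \<in> L2_fun. L2_norm f \<le> 1}. L2_norm (T f))"

text \<open>For \<open>f \<in> L\<^sup>2\<close> and \<open>K\<close> integrable on the truncation region, the integral converges
  absolutely for almost every \<open>x\<close>; on the exceptional null set the Bochner integral is \<open>0\<close>.\<close>

definition trunc_op ::
  "(real \<Rightarrow> complex) \<Rightarrow> (real \<Rightarrow> 'a::euclidean_space) \<Rightarrow> real
     \<Rightarrow> ('a \<Rightarrow> complex) \<Rightarrow> ('a \<Rightarrow> complex)" where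
  "trunc_op K \<gamma> \<epsilon> f =
     (\<lambda>x. LINT t:trunc_region \<epsilon>|lebesgue. f (x - \<gamma> t) * K t)"

text \<open>The principal value is infinite in the sense that the moduli of the truncated integrals
  tend to \<open>\<infinity>\<close>; the filter \<open>at_infinity\<close> is generated by complements of bounded sets.\<close>

definition pv_infinite :: "(real \<Rightarrow> complex) \<Rightarrow> bool" where
  "pv_infinite g \<longleftrightarrow>
     filterlim (\<lambda>\<epsilon>. LINT t:trunc_region \<epsilon>|lebesgue. g t) at_infinity (at_right 0)"

end

theory Submission
  imports Defs "HOL-Real_Asymp.Real_Asymp"
begin

text \<open>Pairing an average \<open>\<integral> 1\<^sub>A(x - \<gamma>(t)) k(t) dt\<close> with \<open>1\<^sub>B\<close> gives, by Fubini, the integral of \<open>k(t)\<close>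
  against the volume of \<open>B \<inter> (A + \<gamma>(t))\<close>, so an \<open>L\<^sup>2\<close> bound for the operator controls it.
  For two intervals of length \<open>2a\<close> whose centres differ by \<open>a\<close>, the length of the overlap is an affine
  function of a shift of size at most \<open>a\<close>.  Taking for \<open>A\<close> and \<open>B\<close> boxes with such \<open>j\<close>-th sides, where
  \<open>a\<close> bounds \<open>\<gamma>\<^sub>j\<close>, and letting the other sides tend to infinity, one bounds
  \<open>\<integral> (a \<plusminus> \<gamma>\<^sub>j) k\<close>, and hence \<open>\<integral> \<gamma>\<^sub>j k\<close>, by a constant depending only on \<open>a\<close> and the operator norm.\<close>

section \<open>Averages of translates over a sigma-finite parameter space\<close>

lemma sigma_finite_completion:
  assumes "sigma_finite_measure M"
  shows "sigma_finite_measure (completion M)"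
proof -
  interpret sigma_finite_measure M by fact
  obtain A where "countable A" "A \<subseteq> sets M" "\<Union>A = space M" "\<forall>a\<in>A. emeasure M a \<noteq> \<infinity>"
    using sigma_finite_countable by metis
  moreover have "emeasure (completion M) a = emeasure M a" if "a \<in> sets M" for a
    using that by simp
  ultimately show ?thesis
    by unfold_locales (rule exI[of _ A], auto)
qed

text \<open>The truncation is meant to be absorbed into \<open>k\<close>, which makes the kernel
  integrable over the whole parameter space. Sigma-finiteness of \<open>M\<close> is there for
  Fubini.\<close>

locale translation_average = sigma_finite_measure M for M :: "'b measure" +
  fixes k :: "'b \<Rightarrow> complex" and \<gamma> :: "'b \<Rightarrow> 'a::euclidean_space"
  assumes integrable_k: "integrable M k"
    and measurable_\<gamma> [measurable]: "\<gamma> \<in> borel_measurable M"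
begin

definition average :: "('a \<Rightarrow> complex) \<Rightarrow> 'a \<Rightarrow> complex" where
  "average f x = (LINT t|M. f (x - \<gamma> t) * k t)"

definition overlap :: "'a set \<Rightarrow> 'a set \<Rightarrow> 'b \<Rightarrow> real" where
  "overlap A B t = measure lborel (B \<inter> {x. x - \<gamma> t \<in> A})"

lemma measurable_k [measurable]: "k \<in> borel_measurable M"
  using integrable_k by auto

lemma average_measurable:
  assumes [measurable]: "f \<in> borel_measurable borel"
  shows "average f \<in> borel_measurable lborel"
  unfolding average_def by measurable

lemma overlap_le:
  assumes [measurable]: "A \<in> sets borel" "B \<in> sets borel" and "emeasure lborel B < \<infinity>"
  shows "overlap A B t \<le> measure lborel B"
proof -
  have "{x. x - \<gamma> t \<in> A} \<in> sets borel" by measurable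
  then show ?thesis
    unfolding overlap_def using assms by (intro measure_mono_fmeasurable) (auto simp: fmeasurable_def)
qed

text \<open>Fubini applies because the integrand is dominated by the indicator of \<open>B\<close>
  at \<open>x\<close> times the modulus of \<open>k t\<close>, and \<open>B\<close> has finite
  volume. For fixed \<open>t\<close>, integrating first in \<open>x\<close> leaves the volume of the
  part of \<open>B\<close> covered by the translate of \<open>A\<close>.\<close>

lemma integral_average_indicator:
  assumes [measurable]: "A \<in> sets borel" "B \<in> sets borel" and B: "emeasure lborel B < \<infinity>"
  shows "overlap A B \<in> borel_measurable M"
    and "integrable lborel (\<lambda>x. indicator B x * average (indicator A) x)"
    and "(LINT x|lborel. indicator B x * average (indicator A) x) =
          (LINT t|M. of_real (overlap A B t) * k t)"
proof -
  interpret P: pair_sigma_finite lborel M ..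
  define F :: "'a \<Rightarrow> 'b \<Rightarrow> complex"
    where "F x t = indicator B x * (indicator A (x - \<gamma> t) * k t)" for x t
  have Fm [measurable]: "case_prod F \<in> borel_measurable (lborel \<Otimes>\<^sub>M M)"
    unfolding F_def by measurable
  have int_k: "integrable M (\<lambda>t. cmod (k t))" using integrable_k by simp
  have intF: "integrable M (F x)" for x
    by (rule Bochner_Integration.integrable_bound[OF integrable_k])
       (auto simp: F_def norm_mult indicator_def)
  have bnd: "(LINT t|M. cmod (F x t)) \<le> indicator B x * (LINT t|M. cmod (k t))" for x
  proof -
    have "(LINT t|M. cmod (F x t)) \<le> (LINT t|M. indicator B x * cmod (k t))"
      by (rule integral_mono[OF integrable_norm[OF intF] integrable_mult_right[OF int_k]])
         (auto simp: F_def norm_mult indicator_def)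
    then show ?thesis by simp
  qed
  have F: "integrable (lborel \<Otimes>\<^sub>M M) (case_prod F)"
  proof (rule P.Fubini_integrable)
    show "integrable lborel (\<lambda>x. LINT t|M. norm (case_prod F (x, t)))"
    proof (rule Bochner_Integration.integrable_bound)
      show "integrable lborel (\<lambda>x. indicator B x * (LINT t|M. cmod (k t)))"
        using B by (intro integrable_mult_left) (auto simp: integrable_indicator_iff)
      show "AE x in lborel. norm (LINT t|M. norm (case_prod F (x, t)))
              \<le> norm (indicator B x * (LINT t|M. cmod (k t)))"
        using bnd by (auto intro!: AE_I2 order_trans[OF bnd] simp: abs_mult)
    qed measurable
  qed (use intF in auto)
  have inner: "(LINT t|M. F x t) = indicator B x * average (indicator A) x" for x
    unfolding F_def average_def by simp
  have outer: "(LINT x|lborel. F x t) = of_real (overlap A B t) * k t" for t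
  proof -
    have "F x t = of_real (indicator (B \<inter> {x. x - \<gamma> t \<in> A}) x) * k t" for x
      by (auto simp: F_def indicator_def)
    moreover have "{x. x - \<gamma> t \<in> A} \<in> sets borel" by measurable
    ultimately show ?thesis
      by (simp add: overlap_def)
  qed
  \<comment> \<open>Overlap volumes are the measures of the \<open>t\<close>-sections of a single
    measurable subset of the product, hence depend measurably on \<open>t\<close>.\<close>
  have "Measurable.pred (M \<Otimes>\<^sub>M lborel) (\<lambda>(t,x). x \<in> B \<and> x - \<gamma> t \<in> A)" by measurable
  then have *: "{p \<in> space (M \<Otimes>\<^sub>M lborel). case p of (t, x) \<Rightarrow> x \<in> B \<and> x - \<gamma> t \<in> A} \<in> sets (M \<Otimes>\<^sub>M lborel)"
    by measurable
  have "(\<lambda>t. measure lborel (Pair t -` {p \<in> space (M \<Otimes>\<^sub>M lborel). case p of (t, x) \<Rightarrow> x \<in> B \<and> x - \<gamma> t \<in> A}))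
        \<in> borel_measurable M"
    unfolding measure_def by (rule borel_measurable_enn2real[OF lborel.measurable_emeasure_Pair[OF *]])
  then show "overlap A B \<in> borel_measurable M"
    by (rule measurable_cong[THEN iffD1, rotated])
       (auto simp: overlap_def space_pair_measure intro!: arg_cong[where f="measure lborel"])
  show "integrable lborel (\<lambda>x. indicator B x * average (indicator A) x)"
    using P.integrable_fst[OF F] inner by simp
  show "(LINT x|lborel. indicator B x * average (indicator A) x) =
          (LINT t|M. of_real (overlap A B t) * k t)"
    using P.Fubini_integral[OF F] inner outer by simp
qed

text \<open>The test function is the indicator of \<open>A\<close> normalised in L2. Since
  \<open>B\<close> is no larger than \<open>A\<close>, the pairing is at most a constant times the
  volume of \<open>A\<close>; dividing by that volume leaves a bound independent of both sets, so it
  survives when they grow.\<close>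

lemma overlap_integral_bound:
  assumes [measurable]: "A \<in> sets borel" "B \<in> sets borel"
    and B: "emeasure lborel B < \<infinity>" and A: "measure lborel A > 0"
    and BA: "measure lborel B \<le> measure lborel A"
    and C: "(\<integral>\<^sup>+x. ennreal ((cmod (average (\<lambda>y. of_real (indicator A y / sqrt (measure lborel A))) x))\<^sup>2) \<partial>lborel)
              \<le> ennreal (C\<^sup>2)"
  shows "cmod (LINT t|M. of_real (overlap A B t / measure lborel A) * k t) \<le> (C\<^sup>2 + 1) / 2"
proof -
  define m where "m = measure lborel A"
  have m: "m > 0" using A by (simp add: m_def)
  define u where "u = average (indicator A)"
  have um [measurable]: "u \<in> borel_measurable lborel"
    unfolding u_def by (rule average_measurable) measurable
  have av: "average (\<lambda>y. of_real (indicator A y / sqrt m)) x = u x / of_real (sqrt m)" for x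
  proof -
    have "of_real (indicator A y) = (indicator A y :: complex)" for y
      by (simp add: indicator_def)
    then show ?thesis unfolding u_def average_def by simp
  qed
  define w where "w x = (cmod (u x))\<^sup>2 / m" for x
  have [measurable]: "w \<in> borel_measurable lborel"
    unfolding w_def by measurable
  have w0: "0 \<le> w x" for x
    using m by (simp add: w_def)
  have C': "(\<integral>\<^sup>+x. ennreal (w x) \<partial>lborel) \<le> ennreal (C\<^sup>2)"
    using C m unfolding m_def[symmetric] av by (simp add: w_def norm_divide power_divide)
  have iw: "integrable lborel w"
    using C' w0 by (intro integrableI_bounded) (auto simp: order_le_less_trans)
  have lw: "integral\<^sup>L lborel w \<le> C\<^sup>2"
    using C' w0 by (subst (asm) nn_integral_eq_integral[OF iw]) auto
  have iB: "integrable lborel (indicator B :: 'a \<Rightarrow> real)"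
    using B by (auto simp: integrable_indicator_iff)
  note L = integral_average_indicator[OF assms(1,2) B, folded u_def]
  have "cmod (LINT t|M. of_real (overlap A B t) * k t) \<le> (LINT x|lborel. cmod (indicator B x * u x))"
    unfolding L(3)[symmetric] by (rule integral_norm_bound)
  also have "\<dots> \<le> (LINT x|lborel. m * w x / 2 + indicator B x / 2)"
  proof (rule integral_mono)
    show "integrable lborel (\<lambda>x. cmod (indicator B x * u x))" using L(2) by (rule integrable_norm)
    show "integrable lborel (\<lambda>x. m * w x / 2 + indicator B x / 2)"
      using iw iB by (intro Bochner_Integration.integrable_add integrable_divide integrable_mult_right)
    fix x
    \<comment> \<open>AM-GM instead of Cauchy--Schwarz: any bound proportional to the volume of \<open>A\<close> suffices.\<close>
    have "0 \<le> (cmod (u x) - 1)\<^sup>2" by simp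
    then have "2 * cmod (u x) \<le> (cmod (u x))\<^sup>2 + 1" by (simp add: power2_diff)
    then show "cmod (indicator B x * u x) \<le> m * w x / 2 + indicator B x / 2"
      using m by (auto simp: indicator_def w_def)
  qed
  also have "\<dots> = m * integral\<^sup>L lborel w / 2 + measure lborel B / 2"
    using iw iB by (subst Bochner_Integration.integral_add) auto
  also have "\<dots> \<le> m * C\<^sup>2 / 2 + m / 2"
    using lw m BA by (auto simp: m_def intro!: add_mono mult_left_mono)
  finally have "cmod (LINT t|M. of_real (overlap A B t) * k t) \<le> m * ((C\<^sup>2 + 1) / 2)"
    by (simp add: algebra_simps)
  moreover have "(LINT t|M. of_real (overlap A B t / m) * k t) =
      (LINT t|M. of_real (overlap A B t) * k t) / of_real m"
    by simp
  ultimately show ?thesis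
    using m unfolding m_def[symmetric] by (simp add: norm_divide divide_le_eq mult.commute)
qed

end

section \<open>Volumes of overlaps of boxes\<close>

lemma measure_cbox_Int:
  fixes p q r :: "real ^ 'n"
  assumes "\<And>i. \<bar>p $ i - q $ i\<bar> \<le> 2 * r $ i"
  shows "measure lborel (cbox (p - r) (p + r) \<inter> cbox (q - r) (q + r)) =
          (\<Prod>i\<in>UNIV. 2 * r $ i - \<bar>p $ i - q $ i\<bar>)"
proof -
  define l u where "l = (\<chi> i. max ((p - r) $ i) ((q - r) $ i))"
    and "u = (\<chi> i. min ((p + r) $ i) ((q + r) $ i))"
  have side: "u $ i - l $ i = 2 * r $ i - \<bar>p $ i - q $ i\<bar>" for i
    by (auto simp: l_def u_def)
  \<comment> \<open>The volume is the product of the side differences only for a nonempty box;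
    otherwise two negative factors could give a positive product.\<close>
  then have "l $ i \<le> u $ i" for i
    using assms[of i] by (metis diff_ge_0_iff_ge)
  then have "cbox l u \<noteq> {}"
    by (auto simp: interval_ne_empty_cart)
  moreover have "cbox (p - r) (p + r) \<inter> cbox (q - r) (q + r) = cbox l u"
    by (simp add: Int_interval_cart l_def u_def interval_cbox_cart)
  ultimately show ?thesis
    by (simp add: content_cbox_cart side)
qed

text \<open>Both boxes have half-sides \<open>r\<close>, and after translation their centres differ
  by \<open>v + c\<close>, so the normalised overlap factors over the coordinates.\<close>

lemma translated_box_overlap_ratio:
  fixes c v r :: "real ^ 'n"
  assumes r: "\<And>i. 0 < r $ i" and v: "\<And>i. \<bar>v $ i + c $ i\<bar> \<le> 2 * r $ i"
  shows "measure lborel (cbox (- r) r \<inter> {x. x - v \<in> cbox (c - r) (c + r)}) /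
           measure lborel (cbox (c - r) (c + r)) = (\<Prod>i\<in>UNIV. 1 - \<bar>v $ i + c $ i\<bar> / (2 * r $ i))"
proof -
  have "{x. x - v \<in> cbox (c - r) (c + r)} = cbox (v + c - r) (v + c + r)"
    by (auto simp: mem_box_cart algebra_simps)
  then have "measure lborel (cbox (- r) r \<inter> {x. x - v \<in> cbox (c - r) (c + r)}) =
      (\<Prod>i\<in>UNIV. 2 * r $ i - \<bar>v $ i + c $ i\<bar>)"
    using measure_cbox_Int[of "v + c" 0 r] v by (simp add: Int_commute)
  moreover have "measure lborel (cbox (c - r) (c + r)) = (\<Prod>i\<in>UNIV. 2 * r $ i)"
    using measure_cbox_Int[of c c r] r by (simp add: less_imp_le)
  moreover have "1 - \<bar>v $ i + c $ i\<bar> / (2 * r $ i) = (2 * r $ i - \<bar>v $ i + c $ i\<bar>) / (2 * r $ i)" for i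
    using r[of i] by (simp add: field_simps)
  ultimately show ?thesis
    by (simp only: prod_dividef)
qed

text \<open>Half-sides of a box that stays fixed in direction \<open>j\<close> and grows in all
  others; \<open>Suc\<close> keeps them positive at \<open>N = 0\<close>.\<close>

definition elongated :: "'n \<Rightarrow> real \<Rightarrow> nat \<Rightarrow> real ^ 'n" where
  "elongated j a N = (\<chi> i. if i = j then a else real (Suc N))"

text \<open>The factors with \<open>i\<close> different from \<open>j\<close> tend to 1, because the
  shift is fixed while the sides grow; the factor at \<open>j\<close> is constant in
  \<open>N\<close>. In this way the coordinates of the curve that carry no bound disappear in the
  limit.\<close>

lemma elongated_overlap_ratio_tendsto:
  fixes v :: "real ^ 'n" and j :: 'n and a c :: real
  defines "r \<equiv> elongated j a" and "b \<equiv> axis j c"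
  assumes a: "0 < a" and v: "\<bar>v $ j\<bar> \<le> a" and c: "\<bar>c\<bar> \<le> a"
  shows "(\<lambda>N. measure lborel (cbox (- r N) (r N) \<inter> {x. x - v \<in> cbox (b - r N) (b + r N)}) /
           measure lborel (cbox (b - r N) (b + r N))) \<longlonglongrightarrow> 1 - \<bar>v $ j + c\<bar> / (2 * a)"
proof -
  have "(\<lambda>N. 1 - \<bar>v $ i + b $ i\<bar> / (2 * r N $ i)) \<longlonglongrightarrow>
      (if i = j then 1 - \<bar>v $ j + c\<bar> / (2 * a) else 1)" for i
  proof (cases "i = j")
    case False
    then show ?thesis
      unfolding r_def elongated_def by simp real_asymp
  qed (simp add: r_def b_def elongated_def axis_def)
  then have "(\<lambda>N. \<Prod>i\<in>UNIV. 1 - \<bar>v $ i + b $ i\<bar> / (2 * r N $ i)) \<longlonglongrightarrow>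
      (\<Prod>i\<in>UNIV. if i = j then 1 - \<bar>v $ j + c\<bar> / (2 * a) else 1)"
    by (rule tendsto_prod)
  \<comment> \<open>For small \<open>N\<close> the boxes may fail to meet. Once \<open>N\<close> is
    at least the norm of \<open>v\<close>, the product formula holds: in direction \<open>j\<close>
    the shift is at most \<open>a + a\<close>, and in the others at most
    \<open>2 * Suc N\<close>.\<close>
  moreover have "eventually (\<lambda>N. (\<Prod>i\<in>UNIV. 1 - \<bar>v $ i + b $ i\<bar> / (2 * r N $ i)) =
      measure lborel (cbox (- r N) (r N) \<inter> {x. x - v \<in> cbox (b - r N) (b + r N)}) /
           measure lborel (cbox (b - r N) (b + r N))) sequentially"
    using eventually_ge_at_top[of "nat \<lceil>norm v\<rceil>"]
  proof eventually_elim
    case (elim N)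
    have "\<bar>v $ i\<bar> \<le> 2 + 2 * real N" for i
      using component_le_norm_cart[of v i] elim by linarith
    then have "\<bar>v $ i + b $ i\<bar> \<le> 2 * r N $ i" for i
      using v c by (cases "i = j") (auto simp: r_def b_def elongated_def axis_def)
    moreover have "0 < r N $ i" for i
      using a by (auto simp: r_def elongated_def)
    ultimately show ?case
      by (intro translated_box_overlap_ratio[symmetric])
  qed
  ultimately show ?thesis
    by (simp add: tendsto_cong)
qed

section \<open>Bounding the integral of the bounded coordinate against the kernel\<close>

context
  fixes M :: "'b measure" and k :: "'b \<Rightarrow> complex" and \<gamma> :: "'b \<Rightarrow> real ^ 'n" and j :: 'n and a C :: real
  assumes transl: "translation_average M k \<gamma>"
    and a: "0 < a" and bounded: "AE t in M. \<bar>\<gamma> t $ j\<bar> \<le> a"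
    and L2_bound: "\<And>f. f \<in> borel_measurable borel \<Longrightarrow> (\<integral>\<^sup>+x. ennreal ((cmod (f x))\<^sup>2) \<partial>lborel) \<le> 1 \<Longrightarrow>
      (\<integral>\<^sup>+x. ennreal ((cmod (translation_average.average M k \<gamma> f x))\<^sup>2) \<partial>lborel) \<le> ennreal (C\<^sup>2)"
begin

interpretation translation_average M k \<gamma> by (fact transl)

lemma measurable_coordinate [measurable]: "(\<lambda>t. \<gamma> t $ j) \<in> borel_measurable M"
  by (rule borel_measurable_continuous_on[OF _ measurable_\<gamma>]) (intro continuous_intros)

text \<open>The overlap bound holds with the same constant for every \<open>N\<close>. The
  normalised overlaps lie between 0 and 1, so the modulus of \<open>k\<close> dominates and the
  bound passes to the limit of elongated boxes.\<close>

lemma coordinate_overlap_bound: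
  assumes c: "\<bar>c\<bar> \<le> a"
  shows "cmod (LINT t|M. of_real (1 - \<bar>\<gamma> t $ j + c\<bar> / (2 * a)) * k t) \<le> (C\<^sup>2 + 1) / 2"
proof -
  define r where "r = elongated j a"
  define b where "b = (axis j c :: real ^ 'n)"
  define A B where "A N = cbox (b - r N) (b + r N)" and "B N = cbox (- r N) (r N)" for N
  have rpos: "0 < r N $ i" for N i
    using a by (simp add: r_def elongated_def)
  have m: "measure lborel (A N) = (\<Prod>i\<in>UNIV. 2 * r N $ i)"
    "measure lborel (B N) = (\<Prod>i\<in>UNIV. 2 * r N $ i)" for N
    using measure_cbox_Int[of b b "r N"] measure_cbox_Int[of 0 0 "r N"] rpos[of N]
    by (auto simp: A_def B_def less_imp_le)
  have mpos: "0 < measure lborel (A N)" for N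
    unfolding m using rpos by (intro prod_pos) auto
  have sets [measurable]: "A N \<in> sets borel" "B N \<in> sets borel" for N
    by (auto simp: A_def B_def)
  have fin: "emeasure lborel (A N) < \<infinity>" "emeasure lborel (B N) < \<infinity>" for N
    using emeasure_lborel_cbox_finite by (auto simp: A_def B_def)
  note overlap_m [measurable] = integral_average_indicator(1)[OF sets fin(2)]
  define \<rho> where "\<rho> N t = overlap (A N) (B N) t / measure lborel (A N)" for N t
  have \<rho>m [measurable]: "\<rho> N \<in> borel_measurable M" for N
    unfolding \<rho>_def by measurable
  have \<rho>1: "0 \<le> \<rho> N t" "\<rho> N t \<le> 1" for N t
    using overlap_le[OF sets fin(2), of N N t] mpos[of N]
    by (auto simp: \<rho>_def m overlap_def)
  have "cmod (LINT t|M. of_real (\<rho> N t) * k t) \<le> (C\<^sup>2 + 1) / 2" for N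
    unfolding \<rho>_def
  proof (rule overlap_integral_bound[OF sets fin(2) mpos])
    show "measure lborel (B N) \<le> measure lborel (A N)" by (simp add: m)
    show "(\<integral>\<^sup>+x. ennreal ((cmod (average (\<lambda>y. of_real (indicator (A N) y / sqrt (measure lborel (A N)))) x))\<^sup>2) \<partial>lborel)
        \<le> ennreal (C\<^sup>2)"
    proof (rule L2_bound)
      have "(\<integral>\<^sup>+x. ennreal ((cmod (of_real (indicator (A N) x / sqrt (measure lborel (A N)))))\<^sup>2) \<partial>lborel)
          = (\<integral>\<^sup>+x. ennreal (1 / measure lborel (A N)) * indicator (A N) x \<partial>lborel)"
        using mpos[of N] by (intro nn_integral_cong) (auto simp: norm_divide power_divide split: split_indicator)
      also have "\<dots> = ennreal (1 / measure lborel (A N)) * emeasure lborel (A N)"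
        by (subst nn_integral_cmult_indicator) auto
      also have "\<dots> = 1"
        using fin(1)[of N] mpos[of N]
        by (subst emeasure_eq_ennreal_measure) (auto simp: ennreal_mult[symmetric])
      finally show "(\<integral>\<^sup>+x. ennreal ((cmod (of_real (indicator (A N) x / sqrt (measure lborel (A N)))))\<^sup>2) \<partial>lborel) \<le> 1"
        by simp
    qed measurable
  qed
  moreover have "(\<lambda>N. LINT t|M. of_real (\<rho> N t) * k t) \<longlonglongrightarrow>
      (LINT t|M. of_real (1 - \<bar>\<gamma> t $ j + c\<bar> / (2 * a)) * k t)"
  proof (rule integral_dominated_convergence[where w = "\<lambda>t. cmod (k t)"])
    show "AE t in M. (\<lambda>N. of_real (\<rho> N t) * k t) \<longlonglongrightarrow> of_real (1 - \<bar>\<gamma> t $ j + c\<bar> / (2 * a)) * k t"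
      using bounded
    proof eventually_elim
      case (elim t)
      from elongated_overlap_ratio_tendsto[OF a elim c]
      have "(\<lambda>N. \<rho> N t) \<longlonglongrightarrow> 1 - \<bar>\<gamma> t $ j + c\<bar> / (2 * a)"
        unfolding \<rho>_def overlap_def A_def B_def r_def b_def .
      then show ?case by (intro tendsto_intros)
    qed
    show "AE t in M. norm (of_real (\<rho> N t) * k t) \<le> cmod (k t)" for N
      using \<rho>1 by (auto simp: norm_mult intro!: mult_left_le_one_le)
    show "integrable M (\<lambda>t. cmod (k t))" using integrable_k by simp
  qed measurable
  ultimately show ?thesis
    by (intro Lim_bounded[OF tendsto_norm]) auto
qed

lemma coordinate_integral_bound: "cmod (LINT t|M. of_real (\<gamma> t $ j) * k t) \<le> a * (C\<^sup>2 + 1)"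
proof -
  define \<phi> where "\<phi> c t = 1 - \<bar>\<gamma> t $ j + c\<bar> / (2 * a)" for c t
  have [measurable]: "\<phi> c \<in> borel_measurable M" for c
    unfolding \<phi>_def by measurable
  have int: "integrable M (\<lambda>t. of_real (\<phi> c t) * k t)" if c: "\<bar>c\<bar> \<le> a" for c
  proof (rule Bochner_Integration.integrable_bound[OF integrable_k])
    show "AE t in M. norm (of_real (\<phi> c t) * k t) \<le> norm (k t)"
      using bounded
    proof eventually_elim
      case (elim t)
      then have "0 \<le> \<phi> c t" "\<phi> c t \<le> 1" using a c by (auto simp: \<phi>_def field_simps)
      then show ?case by (auto simp: norm_mult intro!: mult_left_le_one_le)
    qed
  qed measurable
  have "(LINT t|M. of_real (\<gamma> t $ j) * k t)
      = (LINT t|M. of_real a * (of_real (\<phi> (- a) t) * k t - of_real (\<phi> a t) * k t))"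
  proof (rule integral_cong_AE)
    show "AE t in M. of_real (\<gamma> t $ j) * k t
        = of_real a * (of_real (\<phi> (- a) t) * k t - of_real (\<phi> a t) * k t)"
      using bounded
    proof eventually_elim
      case (elim t)
      then have "\<gamma> t $ j = a * (\<phi> (- a) t - \<phi> a t)" using a by (auto simp: \<phi>_def field_simps)
      then have "complex_of_real (\<gamma> t $ j) = of_real a * (of_real (\<phi> (- a) t) - of_real (\<phi> a t))"
        by (metis of_real_diff of_real_mult)
      then show ?case by (simp only:) (simp add: algebra_simps)
    qed
  qed measurable
  also have "\<dots> = of_real a * ((LINT t|M. of_real (\<phi> (- a) t) * k t) - (LINT t|M. of_real (\<phi> a t) * k t))"
    using a by (simp add: int)
  finally have "cmod (LINT t|M. of_real (\<gamma> t $ j) * k t) =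
      a * cmod ((LINT t|M. of_real (\<phi> (- a) t) * k t) - (LINT t|M. of_real (\<phi> a t) * k t))"
    using a by (simp add: norm_mult)
  also have "\<dots> \<le> a * ((C\<^sup>2 + 1) / 2 + (C\<^sup>2 + 1) / 2)"
    using a unfolding \<phi>_def
    by (intro mult_left_mono norm_triangle_le_diff add_mono coordinate_overlap_bound) auto
  finally show ?thesis by simp
qed

end

section \<open>From the operator norm to bounds on integrals of squares\<close>

lemma L2_norm_le_iff:
  assumes "0 \<le> C"
  shows "L2_norm f \<le> ennreal C \<longleftrightarrow> (\<integral>\<^sup>+x. ennreal ((cmod (f x))\<^sup>2) \<partial>lebesgue) \<le> ennreal (C\<^sup>2)"
proof (cases "(\<integral>\<^sup>+x. ennreal ((cmod (f x))\<^sup>2) \<partial>lebesgue)" rule: ennreal_cases)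
  case (real I)
  then show ?thesis
    using assms real_le_lsqrt[of C I] sqrt_le_D[of I C] by (auto simp: L2_norm_def)
qed (simp add: L2_norm_def top_unique)

text \<open>Links the operator norm, defined over \<open>lebesgue\<close>, with the estimates over
  \<open>lborel\<close>: completing a measure leaves nonnegative integrals unchanged, and Borel
  functions are admissible test functions.\<close>

lemma L2_op_norm_bound:
  assumes "L2_op_norm T \<le> ennreal C" "0 \<le> C" "f \<in> borel_measurable borel"
    and "(\<integral>\<^sup>+x. ennreal ((cmod (f x))\<^sup>2) \<partial>lborel) \<le> 1"
  shows "(\<integral>\<^sup>+x. ennreal ((cmod (T f x))\<^sup>2) \<partial>lborel) \<le> ennreal (C\<^sup>2)"
proof -
  have "L2_norm f \<le> 1"
    using L2_norm_le_iff[of 1 f] assms(4) by (simp add: nn_integral_completion)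
  moreover have "f \<in> borel_measurable lebesgue"
    using assms(3) by (simp add: measurable_completion)
  ultimately have "L2_norm (T f) \<le> L2_op_norm T"
    unfolding L2_op_norm_def L2_fun_def by (intro SUP_upper) (auto intro: le_less_trans)
  also have "\<dots> \<le> ennreal C" by fact
  finally show ?thesis
    using L2_norm_le_iff[OF assms(2), of "T f"] by (simp add: nn_integral_completion)
qed

section \<open>A uniform operator bound contradicts the infinite principal value\<close>

theorem theorem1p5:
  fixes K :: "real \<Rightarrow> complex" and \<gamma> :: "real \<Rightarrow> real ^ 'n"
  assumes "K \<in> borel_measurable lebesgue"
    and "\<And>\<epsilon>. 0 < \<epsilon> \<Longrightarrow> \<epsilon> < 1 \<Longrightarrow>
           (\<integral>\<^sup>+t\<in>trunc_region \<epsilon>. ennreal (cmod (K t)) \<partial>lebesgue) < \<infinity>"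
    and "\<gamma> \<in> borel_measurable lebesgue"
    and "\<exists>j. esssup lebesgue (\<lambda>t. ennreal \<bar>\<gamma> t $ j\<bar>) < \<infinity> \<and>
             pv_infinite (\<lambda>t. complex_of_real (\<gamma> t $ j) * K t)"
  shows "(SUP \<epsilon>\<in>{0<..}. L2_op_norm (trunc_op K \<gamma> \<epsilon>)) = \<infinity>"
proof (rule ccontr)
  assume "(SUP \<epsilon>\<in>{0<..}. L2_op_norm (trunc_op K \<gamma> \<epsilon>)) \<noteq> \<infinity>"
  then obtain C where C: "0 \<le> C" "(SUP \<epsilon>\<in>{0<..}. L2_op_norm (trunc_op K \<gamma> \<epsilon>)) = ennreal C"
    by (metis ennreal_cases infinity_ennreal_def)
  from assms(4) obtain j where sup: "esssup lebesgue (\<lambda>t. ennreal \<bar>\<gamma> t $ j\<bar>) < \<infinity>"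
    and pv: "pv_infinite (\<lambda>t. complex_of_real (\<gamma> t $ j) * K t)" by auto
  from sup obtain s where s: "0 \<le> s" "esssup lebesgue (\<lambda>t. ennreal \<bar>\<gamma> t $ j\<bar>) = ennreal s"
    by (metis ennreal_cases infinity_ennreal_def less_irrefl)
  \<comment> \<open>Adding 1 keeps \<open>a\<close> positive even if the coordinate vanishes almost
    everywhere; \<open>2 * a\<close> is a side length and a divisor.\<close>
  define a where "a = s + 1"
  have a: "0 < a" using s by (simp add: a_def)
  have bounded: "AE t in lebesgue. \<bar>\<gamma> t $ j\<bar> \<le> a"
    using esssup_AE[of "\<lambda>t. ennreal \<bar>\<gamma> t $ j\<bar>" lebesgue]
  proof eventually_elim
    case (elim t)
    then show ?case using s by (simp add: a_def)
  qed
  have bnd: "cmod (LINT t:trunc_region \<epsilon>|lebesgue. complex_of_real (\<gamma> t $ j) * K t) \<le> a * (C\<^sup>2 + 1)"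
    if \<epsilon>: "0 < \<epsilon>" "\<epsilon> < 1" for \<epsilon>
  proof -
    \<comment> \<open>With the cutoff moved into the kernel, \<open>trunc_op\<close> becomes an
      average over the whole line, and the hypothesis on \<open>K\<close> becomes integrability of
      \<open>k\<close>.\<close>
    define k where "k t = indicator (trunc_region \<epsilon>) t * K t" for t
    have "open (trunc_region \<epsilon>)"
      unfolding trunc_region_def by (intro open_Collect_conj open_Collect_less continuous_intros)
    then have [measurable]: "trunc_region \<epsilon> \<in> sets lebesgue" by auto
    note [measurable] = assms(1,3)
    have km: "k \<in> borel_measurable lebesgue" unfolding k_def by measurable
    have "(\<integral>\<^sup>+t. ennreal (cmod (k t)) \<partial>lebesgue) = (\<integral>\<^sup>+t\<in>trunc_region \<epsilon>. ennreal (cmod (K t)) \<partial>lebesgue)"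
      by (intro nn_integral_cong) (auto simp: k_def split: split_indicator)
    then have k: "integrable lebesgue k"
      using assms(2)[OF \<epsilon>] km by (intro integrableI_bounded) auto
    \<comment> \<open>The parameter carries the Lebesgue sigma-algebra, the completion of
      \<open>lborel\<close>, which inherits sigma-finiteness.\<close>
    interpret L: sigma_finite_measure "lebesgue :: real measure"
      by (intro sigma_finite_completion) (rule lborel.sigma_finite_measure_axioms)
    have tr: "translation_average lebesgue k \<gamma>"
      by unfold_locales (use k in measurable)
    have avg: "translation_average.average lebesgue k \<gamma> = trunc_op K \<gamma> \<epsilon>"
      unfolding translation_average.average_def[OF tr] trunc_op_def set_lebesgue_integral_def fun_eq_iff
      by (intro allI Bochner_Integration.integral_cong) (auto simp: k_def split: split_indicator)
    have "L2_op_norm (trunc_op K \<gamma> \<epsilon>) \<le> ennreal C"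
      using \<epsilon> unfolding C(2)[symmetric] by (intro SUP_upper) auto
    then have "cmod (LINT t|lebesgue. of_real (\<gamma> t $ j) * k t) \<le> a * (C\<^sup>2 + 1)"
      using C(1) by (intro coordinate_integral_bound[OF tr a bounded]) (simp add: avg L2_op_norm_bound)
    also have "(LINT t|lebesgue. of_real (\<gamma> t $ j) * k t) =
        (LINT t:trunc_region \<epsilon>|lebesgue. complex_of_real (\<gamma> t $ j) * K t)"
      unfolding set_lebesgue_integral_def
      by (intro Bochner_Integration.integral_cong) (auto simp: k_def split: split_indicator)
    finally show ?thesis .
  qed
  \<comment> \<open>The threshold lies strictly above the bound in \<open>bnd\<close>, which does
    not depend on \<epsilon>.\<close>
  have "\<forall>\<^sub>F \<epsilon> in at_right 0. a * (C\<^sup>2 + 1) + 1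
      \<le> cmod (LINT t:trunc_region \<epsilon>|lebesgue. complex_of_real (\<gamma> t $ j) * K t)"
  proof -
    have "0 < a * (C\<^sup>2 + 1) + 1" using a by (intro add_nonneg_pos) auto
    then show ?thesis
      using pv unfolding pv_infinite_def filterlim_at_infinity[OF order_refl] by blast
  qed
  \<comment> \<open>Local integrability of \<open>K\<close> is given only below 1, which suffices
    for a limit at 0.\<close>
  moreover have "\<forall>\<^sub>F \<epsilon> in at_right 0. 0 < \<epsilon> \<and> \<epsilon> < (1::real)"
    unfolding eventually_at_right[OF zero_less_one] by (intro exI[of _ 1]) auto
  ultimately have "\<forall>\<^sub>F \<epsilon> in at_right (0::real). False"
  proof eventually_elim
    case (elim \<epsilon>)
    then show ?case using bnd[of \<epsilon>] by simp
  qed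
  then show False by simp
qed

end
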